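(* Every Deaconescu number $n$ satisfies $n > 5.86 \cdot 10^{22}$.
   Context: $\phi$ denotes Euler's totient function. $S_2$ denotes Schemmel's totient function: the multiplicative function on positive integers defined on prime powers ($k \geq 1$) by $S_2(2^k) = 0$ and $S_2(p^k) = p^{k-1}(p-2)$ for primes $p > 2$. A Deaconescu number is a positive composite integer $n \geq 4$ such that $S_2(n) \mid \phi(n) - 1$. *)

theory Defs
  imports Complex_Main "HOL-Number_Theory.Number_Theory"
begin

definition schemmel2_pp :: "nat \<Rightarrow> nat \<Rightarrow> nat" where
  "schemmel2_pp p k = (if p = 2 then 0 else p ^ (k - 1) * (p - 2))"

(* The argument 0 is outside the domain of the function; there the value is the
   empty product 1. *)
definition schemmel2 :: "nat \<Rightarrow> nat" where
  "schemmel2 n = (\<Prod>p\<in>prime_factors n. schemmel2_pp p (multiplicity p n))"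

lemma schemmel2_1: "schemmel2 1 = 1"
  by (simp add: schemmel2_def)

lemma schemmel2_prime_power:
  assumes "prime p" "k \<ge> 1"
  shows "schemmel2 (p ^ k) = (if p = 2 then 0 else p ^ (k - 1) * (p - 2))"
  using assms
  by (simp add: schemmel2_def schemmel2_pp_def prime_factors_power prime_prime_factors)

lemma schemmel2_mult_coprime:
  assumes "coprime m n" "m \<ge> 1" "n \<ge> 1"
  shows "schemmel2 (m * n) = schemmel2 m * schemmel2 n"
proof -
  have nz: "m \<noteq> 0" "n \<noteq> 0"
    using assms by auto
  have disj: "prime_factors m \<inter> prime_factors n = {}"
    using assms(1)
    by (metis coprime_common_divisor disjoint_iff in_prime_factors_iff not_prime_unit)
  have l: "multiplicity p (m * n) = multiplicity p m" if "p \<in> prime_factors m" for p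
  proof -
    have "prime p" "\<not> p dvd n" using that disj nz by (auto simp: prime_factors_dvd)
    then show ?thesis
      using nz by (simp add: prime_elem_multiplicity_mult_distrib not_dvd_imp_multiplicity_0)
  qed
  have r: "multiplicity p (m * n) = multiplicity p n" if "p \<in> prime_factors n" for p
  proof -
    have "prime p" "\<not> p dvd m" using that disj nz by (auto simp: prime_factors_dvd)
    then show ?thesis
      using nz by (simp add: prime_elem_multiplicity_mult_distrib not_dvd_imp_multiplicity_0)
  qed
  have "schemmel2 (m * n) =
      (\<Prod>p\<in>prime_factors m \<union> prime_factors n. schemmel2_pp p (multiplicity p (m * n)))"
    using nz by (simp add: schemmel2_def prime_factors_product)
  also have "\<dots> = (\<Prod>p\<in>prime_factors m. schemmel2_pp p (multiplicity p (m * n)))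
                  * (\<Prod>p\<in>prime_factors n. schemmel2_pp p (multiplicity p (m * n)))"
    using disj by (intro prod.union_disjoint) auto
  also have "\<dots> = schemmel2 m * schemmel2 n"
    unfolding schemmel2_def by (simp add: l r)
  finally show ?thesis .
qed

(* Since totient n > 0 for n > 0, the natural-number subtraction is never truncated. *)
definition deaconescu :: "nat \<Rightarrow> bool" where
  "deaconescu n \<longleftrightarrow> n \<ge> 4 \<and> \<not> prime n \<and> schemmel2 n dvd totient n - 1"

end

theory Submission
  imports Defs "HOL-Computational_Algebra.Squarefree"
begin

text \<open>
  A Deaconescu number \<open>n\<close> has at least 17 distinct odd prime factors, so it is at least the
  product \<open>3 \<cdot> 5 \<cdot> 7 \<cdots> 61\<close> of the first 17 odd primes, which is
  \<open>58644190679703485491635 > 5.86 \<cdot> 10\<^sup>2\<^sup>2\<close>.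

  A prime \<open>p\<close> with \<open>p\<^sup>2\<close> dividing \<open>n\<close> would divide both the Euler and the Schemmel totient of
  \<open>n\<close>, hence 1; and Schemmel's totient vanishes on positive even numbers. So \<open>n\<close> is odd and squarefree, and
  with \<open>P\<close> the set of its prime factors the condition reads
  \<open>(\<Prod>p\<in>P. p - 1) = M * (\<Prod>p\<in>P. p - 2) + 1\<close> for some natural number \<open>M\<close>.
  The left side is even, so \<open>M\<close> is odd, and \<open>M = 1\<close> is impossible because \<open>P\<close>, for a composite
  squarefree \<open>n\<close>, has at least two elements. The ratio \<open>R = \<Prod>p\<in>P. (p - 1) / (p - 2)\<close> exceeds \<open>M\<close>, and a
  large ratio needs many primes.

  If \<open>3\<close> is not in \<open>P\<close>, then \<open>R > 3\<close>, whereas at most 16 primes from 5 on give at most \<open>2.87\<close>.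

  If \<open>3\<close> is in \<open>P\<close>, the equation modulo 3 forces every other member of \<open>P\<close> to be 1 modulo 3
  (\<open>other_factors_cong_1_mod_3\<close>). Then 3 divides the left side, so 3 does not divide \<open>M\<close>, and the odd
  number \<open>M > 1\<close> is at least 5. The factor of \<open>R\<close> at 3 is 2, so the other primes, which are all at
  least 7, contribute more than \<open>5 / 2\<close>, whereas at most 15 primes from 7 on give
  at most \<open>2.16\<close>.

  Both extremal claims, on the ratio and on the product, say that the smallest primes are the
  extreme choice; both are instances of one exchange argument (\<open>prod_le_prod_of_exchange\<close>).
\<close>

section \<open>Products over extremal sets of primes\<close>

text \<open>
  After cancelling the common factors, an injection of \<open>A - B\<close> into \<open>B - A\<close> only increases the
  factors, and the factors it misses are at least 1. Decreasing \<open>f\<close> with \<open>B\<close> an initial segment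
  gives upper bounds; increasing \<open>f\<close> with \<open>A\<close> an initial segment gives lower bounds.
\<close>
lemma prod_le_prod_of_exchange:
  fixes f :: "'a \<Rightarrow> 'b :: linordered_idom"
  assumes "finite A" "finite B" "card A \<le> card B"
    and exch: "\<And>a b. a \<in> A - B \<Longrightarrow> b \<in> B - A \<Longrightarrow> f a \<le> f b"
    and ge1: "\<And>x. x \<in> A \<union> B \<Longrightarrow> 1 \<le> f x"
  shows "prod f A \<le> prod f B"
proof -
  have "card (A - B) \<le> card (B - A)"
    using assms(1-3) by (simp add: card_Diff_subset_Int Int_commute)
  then obtain g where g: "g ` (A - B) \<subseteq> B - A" "inj_on g (A - B)"
    using card_le_inj[of "A - B" "B - A"] assms(1,2) by auto
  have pos: "0 \<le> f x" if "x \<in> A \<union> B" for x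
    using ge1[OF that] by (meson order_trans zero_le_one)
  have "prod f (A - B) \<le> prod (f \<circ> g) (A - B)"
    by (rule prod_mono) (use exch g pos in auto)
  also have "\<dots> = prod f (g ` (A - B))"
    using g(2) by (simp add: prod.reindex)
  also have "\<dots> \<le> prod f (B - A)"
    by (rule prod_mono2) (use assms g pos in auto)
  finally have "prod f (A \<inter> B) * prod f (A - B) \<le> prod f (A \<inter> B) * prod f (B - A)"
    by (rule mult_left_mono) (use pos in \<open>auto intro!: prod_nonneg\<close>)
  also have "prod f (A \<inter> B) * prod f (A - B) = prod f A"
    using assms(1) by (metis prod.Int_Diff)
  also have "prod f (A \<inter> B) * prod f (B - A) = prod f B"
    using assms(2) by (metis prod.Int_Diff Int_commute)
  finally show ?thesis .
qed

lemma prod_pred_ratio_le: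
  fixes P :: "nat set"
  assumes "finite P" "\<And>p. p \<in> P \<Longrightarrow> prime p" "\<And>p. p \<in> P \<Longrightarrow> l \<le> p" "3 \<le> l"
    and "card P \<le> card {p. prime p \<and> l \<le> p \<and> p \<le> m}"
  shows "(\<Prod>p\<in>P. (real p - 1) / (real p - 2))
    \<le> (\<Prod>p | prime p \<and> l \<le> p \<and> p \<le> m. (real p - 1) / (real p - 2))"
proof (rule prod_le_prod_of_exchange)
  fix a b assume "a \<in> P - {p. prime p \<and> l \<le> p \<and> p \<le> m}" "b \<in> {p. prime p \<and> l \<le> p \<and> p \<le> m} - P"
  then have "3 \<le> b" "b \<le> a" using assms by force+
  then show "(real a - 1) / (real a - 2) \<le> (real b - 1) / (real b - 2)"
    by (simp add: field_simps)
next
  fix x assume "x \<in> P \<union> {p. prime p \<and> l \<le> p \<and> p \<le> m}"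
  then have "3 \<le> x" using assms by force
  then show "1 \<le> (real x - 1) / (real x - 2)" by simp
qed (use assms in auto)

lemma primes_le_61:
  "{p::nat. prime p \<and> p \<le> 61} = {2,3,5,7,11,13,17,19,23,29,31,37,41,43,47,53,59,61}"
proof -
  have "{p::nat. prime p \<and> p \<le> 61} = set (filter prime [0..<62])" by auto
  also have "\<dots> = set [2,3,5,7,11,13,17,19,23,29,31,37,41,43,47,53,59,61]" by code_simp
  finally show ?thesis by simp
qed

lemma primes_between_61:
  "{p::nat. prime p \<and> l \<le> p \<and> p \<le> 61} =
    {2,3,5,7,11,13,17,19,23,29,31,37,41,43,47,53,59,61} \<inter> {l..}"
  using primes_le_61 by blast

lemma card_gt_16_of_ratio_ge_3:
  assumes "finite P" "\<And>p. p \<in> P \<Longrightarrow> prime p" "\<And>p. p \<in> P \<Longrightarrow> 5 \<le> p"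
    and "3 \<le> (\<Prod>p\<in>P. (real p - 1) / (real p - 2))"
  shows "16 < card P"
proof (rule ccontr)
  assume "\<not> 16 < card P"
  then have "(\<Prod>p\<in>P. (real p - 1) / (real p - 2))
      \<le> (\<Prod>p | prime p \<and> 5 \<le> p \<and> p \<le> 61. (real p - 1) / (real p - 2))"
    by (intro prod_pred_ratio_le) (use assms in \<open>auto simp: primes_between_61\<close>)
  also have "\<dots> < 3" unfolding primes_between_61 by simp
  finally show False using assms(4) by simp
qed

lemma card_gt_15_of_ratio_ge_5_halves:
  assumes "finite P" "\<And>p. p \<in> P \<Longrightarrow> prime p" "\<And>p. p \<in> P \<Longrightarrow> 7 \<le> p"
    and "5 / 2 \<le> (\<Prod>p\<in>P. (real p - 1) / (real p - 2))"
  shows "15 < card P"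
proof (rule ccontr)
  assume "\<not> 15 < card P"
  then have "(\<Prod>p\<in>P. (real p - 1) / (real p - 2))
      \<le> (\<Prod>p | prime p \<and> 7 \<le> p \<and> p \<le> 61. (real p - 1) / (real p - 2))"
    by (intro prod_pred_ratio_le) (use assms in \<open>auto simp: primes_between_61\<close>)
  also have "\<dots> < 5 / 2" unfolding primes_between_61 by simp
  finally show False using assms(4) by simp
qed

lemma prod_odd_primes_ge:
  fixes P :: "nat set"
  assumes "finite P" "\<And>p. p \<in> P \<Longrightarrow> prime p" "\<And>p. p \<in> P \<Longrightarrow> 3 \<le> p" "17 \<le> card P"
  shows "58644190679703485491635 \<le> \<Prod>P"
proof -
  \<comment> \<open>The exchange argument is about ordered rings, hence the detour through the integers.\<close>
  have "(\<Prod>p | prime p \<and> 3 \<le> p \<and> p \<le> 61. int p) \<le> (\<Prod>p\<in>P. int p)"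
  proof (rule prod_le_prod_of_exchange)
    show "card {p::nat. prime p \<and> 3 \<le> p \<and> p \<le> 61} \<le> card P"
      unfolding primes_between_61 using assms(4) by simp
  qed (use assms in \<open>force+\<close>)
  then have "(\<Prod>p | prime p \<and> 3 \<le> p \<and> p \<le> 61. p) \<le> \<Prod>P"
    by (simp only: flip: of_nat_prod of_nat_le_iff[where ?'a = int])
  then show ?thesis unfolding primes_between_61 by simp
qed

section \<open>The equation for the set of prime factors\<close>

lemma prod_pred_gt_prod_pred2:
  fixes P :: "nat set"
  assumes "finite P" "P \<noteq> {}" "\<And>p. p \<in> P \<Longrightarrow> 3 \<le> p"
  shows "(\<Prod>p\<in>P. p - 2) < (\<Prod>p\<in>P. p - 1)"
proof -
  obtain q where "q \<in> P" using assms(2) by blast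
  then show ?thesis
    by (intro prod_mono_strict[of q]) (use assms in force)+
qed

text \<open>
  Split off one prime \<open>q\<close>. Over the remaining primes let \<open>t\<close> be the product of the
  \<open>p - 2\<close> and \<open>u\<close> that of the \<open>p - 1\<close>. Then \<open>t < u\<close>, so
  \<open>(q - 1) * u \<ge> (q - 1) * (t + 1)\<close>, which exceeds \<open>(q - 2) * t\<close> by more than 1. With a single
  prime the equation does hold, so this is where compositeness enters.
\<close>
lemma prod_pred_ne_prod_pred2_plus_1:
  fixes P :: "nat set"
  assumes "finite P" "2 \<le> card P" "\<And>p. p \<in> P \<Longrightarrow> 3 \<le> p"
  shows "(\<Prod>p\<in>P. p - 1) \<noteq> (\<Prod>p\<in>P. p - 2) + 1"
proof -
  have "P \<noteq> {}" using assms(2) by auto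
  then obtain q where q: "q \<in> P" by blast
  define Q where "Q = P - {q}"
  have "card Q \<ge> 1" using assms(2) q assms(1) by (simp add: Q_def)
  then have "Q \<noteq> {}" by auto
  then have lt: "(\<Prod>p\<in>Q. p - 2) < (\<Prod>p\<in>Q. p - 1)"
    by (intro prod_pred_gt_prod_pred2) (use assms in \<open>auto simp: Q_def\<close>)
  have "q \<ge> 3" using assms(3) q by blast
  then obtain r where r: "q = r + 3" by (metis add.commute le_Suc_ex)
  define t u where "t = (\<Prod>p\<in>Q. p - 2)" and "u = (\<Prod>p\<in>Q. p - 1)"
  have "(r + 1) * t + 1 < (r + 2) * (t + 1)" by simp
  also have "\<dots> \<le> (r + 2) * u" using lt unfolding t_def u_def by (intro mult_left_mono) auto
  finally have "(q - 2) * t + 1 < (q - 1) * u" by (simp add: r)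
  then show ?thesis
    using assms(1) q by (simp add: prod.remove[OF assms(1) q] t_def u_def Q_def)
qed

text \<open>
  If some \<open>q\<close> in \<open>P\<close> is 2 modulo 3, then 3 divides \<open>q - 2\<close>, so the left side of the equation is 1
  modulo 3. Hence 3 divides no \<open>p - 1\<close>, and every \<open>p \<noteq> 3\<close> in \<open>P\<close> is 2 modulo 3. The factors
  \<open>p - 1\<close> are then 1 modulo 3, except for the factor 2 at \<open>p = 3\<close>, so that the left side is 2
  modulo 3: a contradiction.
\<close>
lemma other_factors_cong_1_mod_3:
  fixes P :: "nat set"
  assumes "finite P" "\<And>p. p \<in> P \<Longrightarrow> prime p" "3 \<in> P"
    and eq: "(\<Prod>p\<in>P. p - 1) = M * (\<Prod>p\<in>P. p - 2) + 1"
    and q: "q \<in> P" "q \<noteq> 3"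
  shows "q mod 3 = 1"
proof (rule ccontr)
  assume neg: "q mod 3 \<noteq> 1"
  have ndvd: "p mod 3 \<noteq> 0" if "p \<in> P - {3}" for p
    using assms(2)[of p] that primes_dvd_imp_eq[of 3 p] by (auto simp: mod_eq_0_iff_dvd)
  have "q mod 3 = 2" using neg ndvd[of q] q by auto
  moreover have "q \<ge> 2" using assms(2) q prime_ge_2_nat by blast
  ultimately have "3 dvd q - 2" by presburger
  then have "3 dvd (\<Prod>p\<in>P. p - 2)" by (meson assms(1) q(1) dvd_prodI dvd_trans)
  then have "3 dvd M * (\<Prod>p\<in>P. p - 2)" by (rule dvd_mult)
  then have phi: "(\<Prod>p\<in>P. p - 1) mod 3 = 1" unfolding eq by presburger
  have "[p - 1 = 1] (mod 3)" if p: "p \<in> P - {3}" for p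
  proof -
    have "\<not> 3 dvd p - 1"
    proof
      assume "3 dvd p - 1"
      then have "3 dvd (\<Prod>p\<in>P. p - 1)" using p by (meson DiffD1 assms(1) dvd_prodI dvd_trans)
      with phi show False by simp
    qed
    moreover have "3 dvd p - 1" if "p mod 3 = 1" using that by presburger
    ultimately have "p mod 3 = 2" using ndvd[OF p] by linarith
    then have "p = 3 * (p div 3) + 2" using mult_div_mod_eq[of 3 p] by linarith
    then obtain k where "p = 3 * k + 2" by blast
    then show ?thesis by (simp add: cong_def)
  qed
  then have "[(\<Prod>p\<in>P - {3}. p - 1) = (\<Prod>p\<in>P - {3}. 1)] (mod 3)" by (rule cong_prod)
  then have "[2 * (\<Prod>p\<in>P - {3}. p - 1) = 2 * (\<Prod>p\<in>P - {3}. 1)] (mod 3)"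
    by (rule cong_scalar_left)
  moreover have "(\<Prod>p\<in>P. p - 1) = 2 * (\<Prod>p\<in>P - {3}. p - 1)"
    using prod.remove[OF assms(1,3), of "\<lambda>p. p - 1"] by simp
  ultimately show False using phi by (simp add: cong_def)
qed

text \<open>
  The parity of the left side and the residues modulo 3 exclude small \<open>M\<close>, and \<open>M\<close> bounds from
  below the ratio of the two products.
\<close>
lemma card_ge_17:
  fixes P :: "nat set"
  assumes fin: "finite P" and pr: "\<And>p. p \<in> P \<Longrightarrow> prime p" and ge3: "\<And>p. p \<in> P \<Longrightarrow> 3 \<le> p"
    and card: "2 \<le> card P"
    and eq: "(\<Prod>p\<in>P. p - 1) = M * (\<Prod>p\<in>P. p - 2) + 1"
  shows "17 \<le> card P"
proof -
  have "P \<noteq> {}" using card by auto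
  then obtain q where q: "q \<in> P" by blast
  have oddP: "odd p" if "p \<in> P" for p
    using pr[OF that] ge3[OF that] by (simp add: prime_odd_nat)
  have "even (q - 1)" using oddP[OF q] by simp
  then have "even (\<Prod>p\<in>P. p - 1)" by (meson fin q dvd_prodI dvd_trans)
  then have oddM: "odd M" unfolding eq by auto
  have M1: "M \<noteq> 1" using prod_pred_ne_prod_pred2_plus_1[OF fin card ge3] eq by auto
  have S0: "0 < (\<Prod>p\<in>P. real p - 2)" by (rule prod_pos) (use ge3 in force)
  have "real (\<Prod>p\<in>P. p - 1) = (\<Prod>p\<in>P. real p - 1)" "real (\<Prod>p\<in>P. p - 2) = (\<Prod>p\<in>P. real p - 2)"
    using ge3 by (auto intro!: prod.cong simp: of_nat_diff dest!: ge3)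
  then have "(\<Prod>p\<in>P. real p - 1) = real M * (\<Prod>p\<in>P. real p - 2) + 1"
    using arg_cong[OF eq, of real] by simp
  then have ratio: "real M \<le> (\<Prod>p\<in>P. (real p - 1) / (real p - 2))"
    using S0 by (simp add: prod_dividef field_simps)
  show ?thesis
  proof (cases "3 \<in> P")
    case False
    have "5 \<le> p" if "p \<in> P" for p
    proof -
      have "p \<noteq> 3" "p \<noteq> 4" using that False oddP by force+
      with ge3[OF that] show ?thesis by simp
    qed
    moreover have "3 \<le> M" using oddM M1 by presburger
    ultimately have "16 < card P"
      using fin pr ratio by (intro card_gt_16_of_ratio_ge_3) auto
    then show ?thesis by simp
  next
    case True
    define Q where "Q = P - {3}"
    have cardQ: "card P = card Q + 1" using True fin card by (simp add: Q_def)
    have mod1: "p mod 3 = 1" if "p \<in> Q" for p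
      using other_factors_cong_1_mod_3[OF fin pr True eq] that by (simp add: Q_def)
    have "Q \<noteq> {}" using card cardQ by auto
    then obtain r where r: "r \<in> Q" by blast
    have "3 dvd r - 1" using mod1[OF r] by presburger
    then have "3 dvd (\<Prod>p\<in>P. p - 1)" using r unfolding Q_def by (meson DiffD1 fin dvd_prodI dvd_trans)
    then have "\<not> 3 dvd M * (\<Prod>p\<in>P. p - 2)" unfolding eq by presburger
    then have "\<not> 3 dvd M" by (meson dvd_mult2)
    then have "5 \<le> M" using oddM M1 by presburger
    then have "5 / 2 \<le> (\<Prod>p\<in>Q. (real p - 1) / (real p - 2))"
      using ratio unfolding Q_def
      by (simp add: prod.remove[OF fin True])
    moreover have "7 \<le> p" if "p \<in> Q" for p
    proof -
      have "odd p" "3 \<le> p" "p \<noteq> 3" using that oddP ge3 by (auto simp: Q_def)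
      with mod1[OF that] show ?thesis by presburger
    qed
    ultimately have "15 < card Q"
      using fin pr by (intro card_gt_15_of_ratio_ge_5_halves) (auto simp: Q_def)
    then show ?thesis using cardQ by simp
  qed
qed

section \<open>Deaconescu numbers\<close>

lemma squarefree_prods:
  fixes n :: nat
  assumes "squarefree n" "odd n"
  shows "n = \<Prod>(prime_factors n)"
    and "totient n = (\<Prod>p\<in>prime_factors n. p - 1)"
    and "schemmel2 n = (\<Prod>p\<in>prime_factors n. p - 2)"
proof -
  have n: "n > 0" using assms(2) by (rule odd_pos)
  have m: "multiplicity p n = 1" if "p \<in> prime_factors n" for p
    using assms(1) n that by (simp add: squarefree_factorial_semiring')
  have "p \<noteq> 2" if "p \<in> prime_factors n" for p
    using assms(2) that by (auto simp: prime_factors_dvd)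
  then show "schemmel2 n = (\<Prod>p\<in>prime_factors n. p - 2)"
    unfolding schemmel2_def schemmel2_pp_def using m by (auto intro!: prod.cong)
  show "totient n = (\<Prod>p\<in>prime_factors n. p - 1)"
    using totient_formula1[OF n] m by simp
  show "n = \<Prod>(prime_factors n)"
    using prod_prime_factors[of n] n m by simp
qed

lemma deaconescu_totient:
  assumes "deaconescu n"
  obtains M where "totient n = M * schemmel2 n + 1"
proof -
  have "totient n > 0" using assms by (simp add: deaconescu_def)
  moreover obtain M where "totient n - 1 = M * schemmel2 n"
    using assms unfolding deaconescu_def dvd_def by (metis mult.commute)
  ultimately have "totient n = M * schemmel2 n + 1" by linarith
  then show ?thesis using that by blast
qed

text \<open>
  On positive even numbers Schemmel's totient is 0, and 0 divides \<open>totient n - 1\<close> only if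
  \<open>totient n = 1\<close>.
\<close>
lemma deaconescu_odd:
  assumes "deaconescu n"
  shows "odd n"
proof
  assume "even n"
  have n: "n \<ge> 4" using assms by (simp add: deaconescu_def)
  with \<open>even n\<close> have "2 \<in> prime_factors n" by (auto simp: prime_factors_dvd)
  then have "schemmel2 n = 0"
    unfolding schemmel2_def by (intro prod_zero) (auto simp: schemmel2_pp_def)
  then have "totient n = 1" using deaconescu_totient[OF assms] by auto
  with totient_gt_1[of n] n show False by simp
qed

text \<open>
  A repeated prime factor of \<open>n\<close> divides both totients of \<open>n\<close>, but these are coprime.
\<close>
lemma deaconescu_squarefree:
  assumes "deaconescu n"
  shows "squarefree n"
proof -
  have n: "n > 0" using assms by (simp add: deaconescu_def)
  obtain M where M: "totient n = M * schemmel2 n + 1" using deaconescu_totient[OF assms] .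
  have "multiplicity p n = 1" if p: "p \<in> prime_factors n" for p
  proof (rule ccontr)
    assume "multiplicity p n \<noteq> 1"
    moreover have "multiplicity p n > 0" using p by (simp add: prime_factors_multiplicity)
    ultimately have *: "p dvd p ^ (multiplicity p n - 1)" by simp
    have "p dvd totient n"
      unfolding totient_formula1[OF n]
      using dvd_prodI[OF _ p, of "\<lambda>p. p ^ (multiplicity p n - 1) * (p - 1)"]
        dvd_trans[OF dvd_mult2[OF *]] by blast
    moreover have "p dvd schemmel2_pp p (multiplicity p n)"
      using * by (simp add: schemmel2_pp_def)
    then have "p dvd schemmel2 n"
      unfolding schemmel2_def by (rule dvd_trans[OF _ dvd_prodI]) (use p in auto)
    ultimately have "p dvd 1" unfolding M by (metis dvd_add_right_iff dvd_mult)
    moreover have "prime p" using p by blast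
    ultimately show False using not_prime_unit by blast
  qed
  with n show ?thesis by (simp add: squarefree_factorial_semiring')
qed

theorem theorem1p3:
  fixes n :: nat
  assumes "deaconescu n"
  shows "real n > 5.86 * 10 ^ 22"
proof -
  define P where "P = prime_factors n"
  have oddn: "odd n" using deaconescu_odd[OF assms] .
  note prods = squarefree_prods[OF deaconescu_squarefree[OF assms] oddn, folded P_def]
  have fin: "finite P" and pr: "\<And>p. p \<in> P \<Longrightarrow> prime p" by (auto simp: P_def)
  have ge3: "3 \<le> p" if "p \<in> P" for p
  proof -
    have "p \<noteq> 2" using that oddn by (auto simp: P_def prime_factors_dvd)
    with prime_ge_2_nat[OF pr[OF that]] show ?thesis by simp
  qed
  have "card P \<noteq> 0" using prods(1) assms fin by (auto simp: deaconescu_def)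
  moreover have "card P \<noteq> 1"
  proof
    assume "card P = 1"
    then obtain p where "P = {p}" by (auto simp: card_1_singleton_iff)
    then have "n = p" "prime p" using prods(1) pr by simp_all
    with assms show False by (simp add: deaconescu_def)
  qed
  ultimately have "2 \<le> card P" by simp
  obtain M where "totient n = M * schemmel2 n + 1" using deaconescu_totient[OF assms] .
  then have "(\<Prod>p\<in>P. p - 1) = M * (\<Prod>p\<in>P. p - 2) + 1" by (simp only: prods(2,3))
  with \<open>2 \<le> card P\<close> have "17 \<le> card P"
    using card_ge_17[OF fin pr ge3, of M] by blast
  then have "58644190679703485491635 \<le> n"
    using prod_odd_primes_ge[OF fin pr ge3] prods(1) by simp
  then have "real 58644190679703485491635 \<le> real n" by (rule of_nat_mono)
  then show ?thesis by simp
qed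

end
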